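(* Let $X,Y$ be metric spaces and let $f:X\to Y$ be a rough isometry. Then $d_\infty(X)=d_\infty(Y)$.
   Context: For a metric space $(X,\delta)$, $B_X(x,R)$ denotes the open ball with centre $x\in X$ and radius $R$, and for $\Omega\subset X$, $n_r(\Omega)$ denotes the least number (possibly $+\infty$) of open balls of $X$ of radius $r$ which cover $\Omega$. The asymptotic dimension of $X$ is $$d_\infty(X):=\lim_{r\to\infty}\limsup_{R\to\infty}\frac{\log n_r(B_X(x,R))}{\log R}\in[0,\infty],$$ where $x\in X$ is any point (spaces are nonempty; the value does not depend on the choice of $x$, and the limit in $r$ exists by monotonicity). A map $f:X\to Y$ between metric spaces is a rough isometry if there are constants $a\geq 1$, $b,\varepsilon\geq 0$ such that (i) $a^{-1}\delta_X(x_1,x_2)-b\leq \delta_Y(f(x_1),f(x_2))\leq a\,\delta_X(x_1,x_2)+b$ for all $x_1,x_2\in X$, and (ii) $\bigcup_{x\in X}B_Y(f(x),\varepsilon)=Y$. *)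

theory Defs
  imports "HOL-Analysis.Analysis"
begin

text \<open>Natural logarithm of a (possibly infinite) cardinality, with \<open>log 0 = -\<infinity>\<close> and \<open>log \<infinity> = \<infinity>\<close>.\<close>

definition log_enat :: "enat \<Rightarrow> ereal" where
  "log_enat n = (case n of enat k \<Rightarrow> if k = 0 then - \<infinity> else ereal (ln (real k)) | \<infinity> \<Rightarrow> \<infinity>)"

context Metric_space
begin

text \<open>The covering number: the infimum of the empty set of \<^typ>\<open>enat\<close> is \<open>\<infinity>\<close>, which is
  the value for sets admitting no finite cover. The covering balls are balls of the whole space,
  with centres anywhere in \<^term>\<open>M\<close>.\<close>

definition cover_num :: "real \<Rightarrow> 'a set \<Rightarrow> enat" where
  "cover_num r \<Omega> =
     Inf {enat (card \<B>) |\<B>. finite \<B> \<and> \<B> \<subseteq> (\<lambda>c. mball c r) ` M \<and> \<Omega> \<subseteq> \<Union>\<B>}"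

definition growth_exponent :: "'a \<Rightarrow> real \<Rightarrow> ereal" where
  "growth_exponent x r =
     Limsup at_top (\<lambda>R::real. log_enat (cover_num r (mball x R)) / ereal (ln R))"

text \<open>The base point is irrelevant and the limit exists, see \<open>asymptotic_dim_eqI\<close> and
  \<open>tendsto_asymptotic_dim\<close> below.\<close>

definition asymptotic_dim :: ereal where
  "asymptotic_dim = Lim at_top (growth_exponent (SOME x. x \<in> M))"

end

definition rough_isometry ::
  "'a set \<Rightarrow> ('a \<Rightarrow> 'a \<Rightarrow> real) \<Rightarrow> 'b set \<Rightarrow> ('b \<Rightarrow> 'b \<Rightarrow> real) \<Rightarrow> ('a \<Rightarrow> 'b) \<Rightarrow> bool" where
  "rough_isometry X \<delta>X Y \<delta>Y f \<longleftrightarrow>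
     f \<in> X \<rightarrow> Y \<and>
     (\<exists>a b \<epsilon>. a \<ge> 1 \<and> b \<ge> 0 \<and> \<epsilon> \<ge> 0 \<and>
        (\<forall>x1\<in>X. \<forall>x2\<in>X. inverse a * \<delta>X x1 x2 - b \<le> \<delta>Y (f x1) (f x2) \<and>
                        \<delta>Y (f x1) (f x2) \<le> a * \<delta>X x1 x2 + b) \<and>
        (\<Union>x\<in>X. Metric_space.mball Y \<delta>Y (f x) \<epsilon>) = Y)"

lemma log_enat_mono: "m \<le> n \<Longrightarrow> log_enat m \<le> log_enat n"
  by (auto simp: log_enat_def split: enat.splits)

lemma log_enat_nonneg: "n \<noteq> 0 \<Longrightarrow> 0 \<le> log_enat n"
  by (auto simp: log_enat_def zero_enat_def split: enat.splits)

context Metric_space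
begin

lemma cover_num_mono: "\<Omega> \<subseteq> \<Omega>' \<Longrightarrow> cover_num r \<Omega> \<le> cover_num r \<Omega>'"
  unfolding cover_num_def
  by (rule Inf_superset_mono, rule Collect_mono, rule impI, elim exE conjE,
      intro exI conjI, assumption+, rule subset_trans)

lemma cover_num_antimono:
  assumes "r \<le> s" shows "cover_num s \<Omega> \<le> cover_num r \<Omega>"
  unfolding cover_num_def
proof (rule Inf_greatest, clarify)
  fix \<B> assume \<B>: "finite \<B>" "\<B> \<subseteq> (\<lambda>c. mball c r) ` M" "\<Omega> \<subseteq> \<Union>\<B>"
  from \<B>(2) obtain C where C: "C \<subseteq> M" "inj_on (\<lambda>c. mball c r) C" "\<B> = (\<lambda>c. mball c r) ` C"
    unfolding subset_image_inj by (elim exE conjE)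
  have fin: "finite C" using \<B>(1) finite_image_iff[OF C(2)] C(3) by simp
  let ?\<B> = "(\<lambda>c. mball c s) ` C"
  have "\<Omega> \<subseteq> \<Union>?\<B>"
  proof
    fix z assume "z \<in> \<Omega>"
    then obtain c where "c \<in> C" "z \<in> mball c r" using \<B>(3) C(3) by auto
    then show "z \<in> \<Union>?\<B>" using mball_subset_concentric[OF assms] by blast
  qed
  then have "Inf {enat (card \<B>) |\<B>. finite \<B> \<and> \<B> \<subseteq> (\<lambda>c. mball c s) ` M \<and> \<Omega> \<subseteq> \<Union>\<B>}
      \<le> enat (card ?\<B>)"
    using fin C(1) by (intro Inf_lower CollectI exI[of _ ?\<B>] conjI image_mono) auto
  also have "\<dots> \<le> enat (card \<B>)"
    using card_image_le[OF fin] card_image[OF C(2)] C(3) by simp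
  finally show "Inf {enat (card \<B>) |\<B>. finite \<B> \<and> \<B> \<subseteq> (\<lambda>c. mball c s) ` M \<and> \<Omega> \<subseteq> \<Union>\<B>}
      \<le> enat (card \<B>)" .
qed

lemma cover_num_ne_0: "\<Omega> \<noteq> {} \<Longrightarrow> cover_num r \<Omega> \<noteq> 0"
proof -
  assume "\<Omega> \<noteq> {}"
  then have "1 \<le> cover_num r \<Omega>"
    unfolding cover_num_def
  proof (intro Inf_greatest, elim CollectE exE conjE)
    fix n \<B> assume *: "finite \<B>" "\<Omega> \<subseteq> \<Union>\<B>" "n = enat (card \<B>)"
    with \<open>\<Omega> \<noteq> {}\<close> have "\<B> \<noteq> {}" by auto
    with *(1) have "0 < card \<B>" by (simp add: card_gt_0_iff)
    then show "1 \<le> n" using *(3) by (simp add: one_enat_def)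
  qed
  then show ?thesis by auto
qed

lemma growth_exponent_antimono:
  assumes "r \<le> s" shows "growth_exponent x s \<le> growth_exponent x r"
  unfolding growth_exponent_def
proof (rule Limsup_mono)
  show "\<forall>\<^sub>F R in at_top. log_enat (cover_num s (mball x R)) / ereal (ln R)
      \<le> log_enat (cover_num r (mball x R)) / ereal (ln R)"
    using eventually_gt_at_top[of 1]
    by eventually_elim
      (intro ereal_divide_right_mono log_enat_mono cover_num_antimono assms, simp)
qed

lemma growth_exponent_base_le:
  assumes "x \<in> M" "y \<in> M" shows "growth_exponent x r \<le> growth_exponent y r"
proof -
  define D where "D = d x y"
  have D: "D \<ge> 0" unfolding D_def by simp
  have sub: "mball x R \<subseteq> mball y (R + D)" for R
    using assms by (intro mball_subset) (auto simp: D_def)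
  let ?g = "\<lambda>x R. log_enat (cover_num r (mball x R)) / ereal (ln R)"
  have "\<forall>\<^sub>F R in at_top. ?g x R < c" if c: "growth_exponent y r < c" for c
  proof -
    obtain c1 where c1: "growth_exponent y r < ereal c1" "ereal c1 < c"
      using ereal_dense2[OF c] by blast
    obtain c2 where c2: "ereal c1 < ereal c2" "ereal c2 < c"
      using ereal_dense2[OF c1(2)] by blast
    have ev: "\<forall>\<^sub>F R in at_top. ?g y R < ereal c1"
      using c1(1) unfolding growth_exponent_def by (rule Limsup_lessD)
    have "\<forall>\<^sub>F R in at_top. ?g y R < ereal c1 \<and> 1 < R"
      using ev eventually_gt_at_top[of 1] by (rule eventually_conj)
    then obtain R where R: "?g y R < ereal c1" "1 < R"
      using eventually_happens'[OF trivial_limit_at_top_linorder] by blast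
    have "cover_num r (mball y R) \<noteq> 0"
      using assms R(2) by (intro cover_num_ne_0) (simp add: mball_eq_empty)
    then have "0 \<le> ?g y R"
      using R(2) by (subst zero_le_divide_ereal) (simp_all add: log_enat_nonneg)
    then have "0 < ereal c1" using R(1) by (rule le_less_trans)
    then have pos: "0 < c1" by simp
    obtain N where N: "\<And>R. R \<ge> N \<Longrightarrow> ?g y R < ereal c1"
      using ev unfolding eventually_at_top_linorder by auto
    have "\<forall>\<^sub>F R::real in at_top. c1 * ln 2 / (c2 - c1) \<le> ln R"
      by (rule ln_at_top[unfolded filterlim_at_top, rule_format])
    then show ?thesis
      using eventually_gt_at_top[of 1] eventually_ge_at_top[of D] eventually_ge_at_top[of N]
    proof eventually_elim
      case (elim R)
      have lnpos: "0 < ln R" "0 < ln (R + D)" using elim(2) D by auto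
      have "ln (R + D) \<le> ln (2 * R)" using elim D by (subst ln_le_cancel_iff) auto
      also have "\<dots> = ln 2 + ln R" using elim(2) by (simp add: ln_mult)
      finally have "c1 * ln (R + D) \<le> c1 * (ln 2 + ln R)"
        using pos by (intro mult_left_mono) auto
      also have "\<dots> \<le> c2 * ln R"
        using elim(1) c2(1) by (simp add: pos_divide_le_eq algebra_simps)
      finally have ln: "c1 * ln (R + D) \<le> c2 * ln R" .
      have g: "?g y (R + D) < ereal c1" using elim(4) D by (intro N) auto
      have "log_enat (cover_num r (mball x R)) \<le> log_enat (cover_num r (mball y (R + D)))"
        by (intro log_enat_mono cover_num_mono sub)
      also have "\<dots> < ereal c1 * ereal (ln (R + D))"
        using iffD1[OF ereal_divide_less_iff g] lnpos by simp
      also have "\<dots> \<le> ereal c2 * ereal (ln R)"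
        using ln by simp
      finally have "?g x R < ereal c2"
        using lnpos by (subst ereal_divide_less_iff) simp_all
      then show ?case using c2(2) by (rule less_trans)
    qed
  qed
  then show ?thesis
    unfolding growth_exponent_def[of x] by (intro Limsup_le_iff[THEN iffD2] allI impI)
qed

lemma growth_exponent_base: "x \<in> M \<Longrightarrow> y \<in> M \<Longrightarrow> growth_exponent x = growth_exponent y"
  by (intro ext antisym growth_exponent_base_le)

lemma tendsto_growth_exponent:
  "(growth_exponent x \<longlongrightarrow> (INF r. growth_exponent x r)) at_top"
proof (rule decreasing_tendsto)
  fix c assume "(INF r. growth_exponent x r) < c"
  then obtain r where "growth_exponent x r < c" by (auto simp: INF_less_iff)
  then show "\<forall>\<^sub>F s in at_top. growth_exponent x s < c"
    by (intro eventually_mono[OF eventually_ge_at_top[of r]])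
      (rule le_less_trans[OF growth_exponent_antimono])
qed (auto intro!: always_eventually INF_lower)

lemma tendsto_asymptotic_dim:
  assumes "x \<in> M" shows "(growth_exponent x \<longlongrightarrow> asymptotic_dim) at_top"
proof -
  have "growth_exponent (SOME x. x \<in> M) = growth_exponent x"
    using assms by (intro growth_exponent_base) (auto intro: someI)
  then have "asymptotic_dim = (INF r. growth_exponent x r)"
    unfolding asymptotic_dim_def using tendsto_growth_exponent[of x] by (simp add: tendsto_Lim)
  then show ?thesis using tendsto_growth_exponent[of x] by simp
qed

lemma asymptotic_dim_eqI:
  assumes "x \<in> M" "(growth_exponent x \<longlongrightarrow> l) at_top" shows "asymptotic_dim = l"
  using tendsto_unique[OF _ tendsto_asymptotic_dim[OF assms(1)] assms(2)] by simp

end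

end

theory Submission
  imports Defs "HOL-Real_Asymp.Real_Asymp"
begin

text \<open>
  Both inequalities between the two dimensions come from a single principle: the source of a
  quasi-isometric embedding has at most the asymptotic dimension of the target
  (\<open>asymptotic_dim_le_embedding\<close>). Indeed, such a map
  \<open>g\<close> sends the ball of radius \<open>R\<close> about \<open>x\<close> into the ball of radius \<open>a R + b\<close> about \<open>g x\<close>, and the
  points of the preimage of a ball of radius \<open>r\<close> are pairwise at distance less than \<open>2 a r + c\<close>, so
  the preimage lies in a ball of that radius centred at any of its own points.
  Pulling back a cover therefore bounds the covering numbers of the source at scale \<open>2 a r + c\<close> by those of the target at scale \<open>r\<close>
  (\<open>cover_num_le_embedding\<close>). The change from \<open>R\<close> to \<open>a R + b\<close> is invisible after division by
  \<open>ln R\<close>, because \<open>ln (a R + b) / ln R\<close> tends to 1 (\<open>Limsup_div_ln_affine_le\<close>); the change from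
  \<open>r\<close> to \<open>2 a r + c\<close> is invisible in the limit \<open>r \<rightarrow> \<infinity>\<close>.

  A rough isometry is such an embedding. Since its image is \<open>\<epsilon>\<close>-dense, choosing for each point \<open>y\<close> a
  point whose image is within \<open>\<epsilon>\<close> of \<open>y\<close> gives a map in the other direction, which is again a
  quasi-isometric embedding by the triangle inequality.
\<close>

text \<open>A real number \<open>c1\<close> above the right-hand side eventually bounds \<open>h (A * R + B)\<close> by
  \<open>c1 * ln (A * R + B)\<close>, and this is eventually below \<open>c2 * ln R\<close> for every \<open>c2 > c1\<close>, because
  the two logarithms are asymptotically equal.\<close>

lemma Limsup_div_ln_affine_le:
  fixes h :: "real \<Rightarrow> ereal" and A B :: real
  assumes A: "A > 0"
  shows "Limsup at_top (\<lambda>R. h (A * R + B) / ereal (ln R))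
    \<le> Limsup at_top (\<lambda>R. h R / ereal (ln R))" (is "_ \<le> ?L")
proof (rule Limsup_le_iff[THEN iffD2], intro allI impI)
  fix c assume "?L < c"
  then obtain c1 where c1: "?L < ereal c1" "ereal c1 < c"
    using ereal_dense2 by blast
  obtain c2 where c2: "ereal c1 < ereal c2" "ereal c2 < c"
    using ereal_dense2[OF c1(2)] by blast
  have affine: "filterlim (\<lambda>R. A * R + B) at_top at_top"
    using A by real_asymp
  have "((\<lambda>R. c1 * (ln (A * R + B) / ln R)) \<longlongrightarrow> c1 * 1) at_top"
    using A by (intro tendsto_mult tendsto_const) real_asymp
  then have ratio: "\<forall>\<^sub>F R in at_top. c1 * (ln (A * R + B) / ln R) < c2"
    using c2(1) by (intro order_tendstoD(2)) auto
  have "\<forall>\<^sub>F R in at_top. h (A * R + B) / ereal (ln (A * R + B)) < ereal c1"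
    using eventually_compose_filterlim[OF Limsup_lessD[OF c1(1)] affine] .
  moreover have "\<forall>\<^sub>F R in at_top. A * R + B > 1"
    using eventually_compose_filterlim[OF eventually_gt_at_top affine] .
  ultimately show "\<forall>\<^sub>F R in at_top. h (A * R + B) / ereal (ln R) < c"
    using ratio eventually_gt_at_top[of 1]
  proof eventually_elim
    case (elim R)
    have lnpos: "0 < ln R" "0 < ln (A * R + B)" using elim by auto
    have "h (A * R + B) < ereal c1 * ereal (ln (A * R + B))"
      using iffD1[OF ereal_divide_less_iff elim(1)] lnpos by simp
    also have "\<dots> \<le> ereal c2 * ereal (ln R)"
      using elim(3) lnpos by (simp add: field_simps)
    finally have "h (A * R + B) / ereal (ln R) < ereal c2"
      using lnpos by (subst ereal_divide_less_iff) simp_all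
    then show ?case using c2(2) by (rule less_trans)
  qed
qed

text \<open>The centre of a ball of the target need not be near the image of \<open>g\<close>, so it cannot be pulled
  back itself; an arbitrary point of the preimage of the ball serves as the new centre, which is why
  the radius doubles.\<close>

lemma cover_num_le_embedding:
  assumes "Metric_space X dX" "Metric_space Y dY" "x \<in> X" "g \<in> X \<rightarrow> Y" "a > 0"
    and upper: "\<And>u v. u \<in> X \<Longrightarrow> v \<in> X \<Longrightarrow> dY (g u) (g v) \<le> a * dX u v + b"
    and lower: "\<And>u v. u \<in> X \<Longrightarrow> v \<in> X \<Longrightarrow> dX u v \<le> a * dY (g u) (g v) + c"
  shows "Metric_space.cover_num X dX (2 * a * r + c) (Metric_space.mball X dX x R)
    \<le> Metric_space.cover_num Y dY r (Metric_space.mball Y dY (g x) (a * R + b))"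
proof -
  interpret X: Metric_space X dX by fact
  interpret Y: Metric_space Y dY by fact
  let ?s = "2 * a * r + c"
  show ?thesis
    unfolding Y.cover_num_def
  proof (rule Inf_greatest, clarify)
    fix \<B> assume \<B>: "finite \<B>" "\<B> \<subseteq> (\<lambda>c. Y.mball c r) ` Y" "Y.mball (g x) (a * R + b) \<subseteq> \<Union>\<B>"
    \<comment> \<open>A ball that misses the image of \<open>g\<close> offers no centre and is dropped.\<close>
    define \<B>1 where "\<B>1 = {B \<in> \<B>. \<exists>u\<in>X. g u \<in> B}"
    define p where "p B = (SOME u. u \<in> X \<and> g u \<in> B)" for B
    have p: "p B \<in> X \<and> g (p B) \<in> B" if "B \<in> \<B>1" for B
      unfolding p_def by (rule someI_ex) (use that in \<open>auto simp: \<B>1_def\<close>)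
    let ?\<C> = "(\<lambda>B. X.mball (p B) ?s) ` \<B>1"
    have fin: "finite \<B>1" using \<B>(1) by (simp add: \<B>1_def)
    have cover: "X.mball x R \<subseteq> \<Union>?\<C>"
    proof
      fix z assume z: "z \<in> X.mball x R"
      then have zX: "z \<in> X" and "a * dX x z < a * R" using \<open>a > 0\<close> by auto
      then have "g z \<in> Y.mball (g x) (a * R + b)"
        using upper[OF \<open>x \<in> X\<close> zX] \<open>x \<in> X\<close> \<open>g \<in> X \<rightarrow> Y\<close> by auto
      then obtain B where B: "B \<in> \<B>" "g z \<in> B" using \<B>(3) by auto
      then have B1: "B \<in> \<B>1" using zX by (auto simp: \<B>1_def)
      obtain q where q: "q \<in> Y" "B = Y.mball q r" using B(1) \<B>(2) by auto
      have "dY (g (p B)) (g z) \<le> dY (g (p B)) q + dY q (g z)"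
        using p[OF B1] B(2) q by (intro Y.triangle) auto
      also have "\<dots> < 2 * r"
        using p[OF B1] B(2) q by (auto simp: Y.commute)
      finally have "a * dY (g (p B)) (g z) < a * (2 * r)"
        using \<open>a > 0\<close> by simp
      with lower[of "p B" z] p[OF B1] zX have "dX (p B) z < ?s" by (simp add: mult_ac)
      then show "z \<in> \<Union>?\<C>" using B1 p[OF B1] zX by auto
    qed
    have "X.cover_num ?s (X.mball x R) \<le> enat (card ?\<C>)"
      unfolding X.cover_num_def
      using fin p cover by (intro Inf_lower CollectI exI[of _ ?\<C>] conjI) auto
    also have "card ?\<C> \<le> card \<B>1" using fin by (rule card_image_le)
    also have "card \<B>1 \<le> card \<B>" using \<B>(1) by (intro card_mono) (auto simp: \<B>1_def)
    finally show "X.cover_num ?s (X.mball x R) \<le> enat (card \<B>)" by simp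
  qed
qed

lemma asymptotic_dim_le_embedding:
  assumes "Metric_space X dX" "Metric_space Y dY" "X \<noteq> {}" "g \<in> X \<rightarrow> Y" "a > 0"
    and "\<And>u v. u \<in> X \<Longrightarrow> v \<in> X \<Longrightarrow> dY (g u) (g v) \<le> a * dX u v + b"
    and "\<And>u v. u \<in> X \<Longrightarrow> v \<in> X \<Longrightarrow> dX u v \<le> a * dY (g u) (g v) + c"
  shows "Metric_space.asymptotic_dim X dX \<le> Metric_space.asymptotic_dim Y dY"
proof -
  interpret X: Metric_space X dX by fact
  interpret Y: Metric_space Y dY by fact
  obtain x where x: "x \<in> X" using \<open>X \<noteq> {}\<close> by auto
  have growth: "X.growth_exponent x (2 * a * r + c) \<le> Y.growth_exponent (g x) r" for r
  proof -
    have "X.growth_exponent x (2 * a * r + c)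
      \<le> Limsup at_top (\<lambda>R. log_enat (Y.cover_num r (Y.mball (g x) (a * R + b))) / ereal (ln R))"
      unfolding X.growth_exponent_def
    proof (rule Limsup_mono)
      show "\<forall>\<^sub>F R in at_top.
          log_enat (X.cover_num (2 * a * r + c) (X.mball x R)) / ereal (ln R)
          \<le> log_enat (Y.cover_num r (Y.mball (g x) (a * R + b))) / ereal (ln R)"
        using eventually_gt_at_top[of 1]
      proof eventually_elim
        case (elim R)
        then show ?case
          by (intro ereal_divide_right_mono log_enat_mono
              cover_num_le_embedding[OF assms(1,2) x assms(4-7)]) auto
      qed
    qed
    also have "\<dots> \<le> Y.growth_exponent (g x) r"
      unfolding Y.growth_exponent_def
      by (rule Limsup_div_ln_affine_le[OF \<open>a > 0\<close>])
    finally show ?thesis .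
  qed
  have "filterlim (\<lambda>r. 2 * a * r + c) at_top at_top"
    using \<open>a > 0\<close> by real_asymp
  then have "((\<lambda>r. X.growth_exponent x (2 * a * r + c)) \<longlongrightarrow> X.asymptotic_dim) at_top"
    by (rule filterlim_compose[OF X.tendsto_asymptotic_dim[OF x]])
  moreover have "(Y.growth_exponent (g x) \<longlongrightarrow> Y.asymptotic_dim) at_top"
    using x \<open>g \<in> X \<rightarrow> Y\<close> by (intro Y.tendsto_asymptotic_dim) auto
  ultimately show ?thesis
    using growth by (intro tendsto_le[OF trivial_limit_at_top_linorder]) auto
qed

theorem theorem1p7:
  fixes X :: "'a set" and \<delta>X :: "'a \<Rightarrow> 'a \<Rightarrow> real"
    and Y :: "'b set" and \<delta>Y :: "'b \<Rightarrow> 'b \<Rightarrow> real"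
    and f :: "'a \<Rightarrow> 'b"
  assumes "Metric_space X \<delta>X" and "X \<noteq> {}"
    and "Metric_space Y \<delta>Y" and "Y \<noteq> {}"
    and "rough_isometry X \<delta>X Y \<delta>Y f"
  shows "Metric_space.asymptotic_dim X \<delta>X = Metric_space.asymptotic_dim Y \<delta>Y"
proof (rule antisym)
  interpret X: Metric_space X \<delta>X by fact
  interpret Y: Metric_space Y \<delta>Y by fact
  obtain a b \<epsilon> where f: "f \<in> X \<rightarrow> Y" and a: "a \<ge> 1"
    and lower': "\<And>u v. u \<in> X \<Longrightarrow> v \<in> X \<Longrightarrow> inverse a * \<delta>X u v - b \<le> \<delta>Y (f u) (f v)"
    and upper: "\<And>u v. u \<in> X \<Longrightarrow> v \<in> X \<Longrightarrow> \<delta>Y (f u) (f v) \<le> a * \<delta>X u v + b"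
    and dense: "(\<Union>x\<in>X. Y.mball (f x) \<epsilon>) = Y"
    using assms(5) unfolding rough_isometry_def by blast
  have apos: "a > 0" using a by simp
  have lower: "\<delta>X u v \<le> a * \<delta>Y (f u) (f v) + a * b" if "u \<in> X" "v \<in> X" for u v
    using lower'[OF that] apos by (simp add: field_simps)
  show "X.asymptotic_dim \<le> Y.asymptotic_dim"
    using asymptotic_dim_le_embedding[OF assms(1,3,2) f apos upper lower] .

  define g where "g y = (SOME x. x \<in> X \<and> \<delta>Y (f x) y < \<epsilon>)" for y
  have g: "g y \<in> X \<and> \<delta>Y (f (g y)) y < \<epsilon>" if "y \<in> Y" for y
    unfolding g_def
  proof (rule someI_ex)
    from that have "y \<in> (\<Union>x\<in>X. Y.mball (f x) \<epsilon>)" using dense by simp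
    then show "\<exists>x. x \<in> X \<and> \<delta>Y (f x) y < \<epsilon>" by auto
  qed
  have near: "\<bar>\<delta>Y (f (g y)) (f (g z)) - \<delta>Y y z\<bar> \<le> 2 * \<epsilon>" if "y \<in> Y" "z \<in> Y" for y z
  proof -
    have mem: "f (g y) \<in> Y" "f (g z) \<in> Y" using g that f by auto
    show ?thesis
      using g[OF that(1)] g[OF that(2)]
        Y.triangle[OF mem(1) that(1) mem(2)] Y.triangle[OF that mem(2)]
        Y.triangle[OF that(1) mem(1) that(2)] Y.triangle[OF mem that(2)]
        Y.commute[of y "f (g y)"] Y.commute[of z "f (g z)"]
      by linarith
  qed
  have g_upper: "\<delta>X (g y) (g z) \<le> a * \<delta>Y y z + (2 * a * \<epsilon> + a * b)" if "y \<in> Y" "z \<in> Y" for y z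
  proof -
    have "a * \<delta>Y (f (g y)) (f (g z)) \<le> a * (\<delta>Y y z + 2 * \<epsilon>)"
      using near[OF that] apos by (intro mult_left_mono) auto
    then show ?thesis
      using lower[of "g y" "g z"] g that by (simp add: algebra_simps)
  qed
  have g_lower: "\<delta>Y y z \<le> a * \<delta>X (g y) (g z) + (b + 2 * \<epsilon>)" if "y \<in> Y" "z \<in> Y" for y z
    using near[OF that] upper[of "g y" "g z"] g that by fastforce
  have "g \<in> Y \<rightarrow> X" using g by auto
  then show "Y.asymptotic_dim \<le> X.asymptotic_dim"
    using asymptotic_dim_le_embedding[OF assms(3,1,4) _ apos g_upper g_lower] by blast
qed

end
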